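(* Let $m\ge 2$ be an integer. Then $\chi'_g(W_3;m,1)=3$, and \[ \chi'_g(W_4;m,1)=\begin{cases} 4 & \text{if } m\neq 3,\\ 5 & \text{if } m=3.\end{cases} \]
   Context: For $n\ge 3$, the wheel $W_n$ is the graph with $n+1$ vertices obtained from the cycle $C_n$ by adding a new vertex $v_0$ adjacent to every vertex of the cycle. The $(m,1)$-edge coloring game on a finite simple graph $G$ with a set of colors $X$ is played alternately by two players, Maker and Breaker, with Maker playing first. On each turn Maker makes $m$ moves and Breaker makes one move; a move consists of coloring one uncolored edge of $G$ with a color from $X$ so that adjacent edges (edges sharing an endpoint) always receive distinct colors. Maker wins if eventually every edge is colored; Breaker wins if at some point the player who is to move cannot color any edge. The $(m,1)$-game chromatic index $\chi'_g(G;m,1)$ is the smallest nonnegative integer $k$ such that Maker has a winning strategy when $|X|=k$. *)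

theory Defs
  imports Main
begin

(* An undirected graph is a pair of its vertex set and its edge set; an edge is the set of its
   two endpoints. *)

type_synonym 'v graph = "'v set \<times> 'v set set"

abbreviation verts :: "'v graph \<Rightarrow> 'v set" where
  "verts \<equiv> fst"

abbreviation edges :: "'v graph \<Rightarrow> 'v set set" where
  "edges \<equiv> snd"

definition finite_simple_graph :: "'v graph \<Rightarrow> bool" where
  "finite_simple_graph G \<longleftrightarrow>
     finite (verts G) \<and> (\<forall>e\<in>edges G. e \<subseteq> verts G \<and> card e = 2)"

definition cycle_graph :: "nat \<Rightarrow> nat graph" where
  "cycle_graph n = ({..<n}, (\<lambda>i. {i, Suc i mod n}) ` {..<n})"

(* The hub is the vertex n, the first number that is not a vertex of the cycle. *)

definition wheel :: "nat \<Rightarrow> nat graph" where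
  "wheel n = (insert n (verts (cycle_graph n)),
              edges (cycle_graph n) \<union> (\<lambda>i. {n, i}) ` verts (cycle_graph n))"

lemma finite_simple_graph_wheel:
  assumes "n \<ge> 3"
  shows "finite_simple_graph (wheel n)" and "card (verts (wheel n)) = n + 1"
proof -
  have rim: "Suc i mod n < n" "i \<noteq> Suc i mod n" if "i < n" for i
    using assms that by (auto simp: mod_Suc)
  show "finite_simple_graph (wheel n)"
    using rim by (auto simp: finite_simple_graph_def wheel_def cycle_graph_def
        card_2_iff doubleton_eq_iff less_Suc_eq)
  show "card (verts (wheel n)) = n + 1"
    by (simp add: wheel_def cycle_graph_def)
qed

(* A move is an edge together with its new color.  A position of the game is the list of all
   moves made so far, oldest first; it determines the partial coloring and whose move it is. *)

type_synonym ('v, 'c) move = "'v set \<times> 'c"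
type_synonym ('v, 'c) position = "('v, 'c) move list"

definition colored_edges :: "('v, 'c) position \<Rightarrow> 'v set set" where
  "colored_edges h = fst ` set h"

definition legal_move :: "'v graph \<Rightarrow> 'c set \<Rightarrow> ('v, 'c) position \<Rightarrow> ('v, 'c) move \<Rightarrow> bool" where
  "legal_move G X h mv \<longleftrightarrow>
     fst mv \<in> edges G - colored_edges h \<and> snd mv \<in> X \<and>
     (\<forall>(f, y) \<in> set h. fst mv \<inter> f \<noteq> {} \<longrightarrow> snd mv \<noteq> y)"

(* Moves are grouped into rounds of m moves by Maker followed by one move by Breaker. *)

definition maker_to_move :: "nat \<Rightarrow> ('v, 'c) position \<Rightarrow> bool" where
  "maker_to_move m h \<longleftrightarrow> length h mod (m + 1) < m"

definition all_colored :: "'v graph \<Rightarrow> ('v, 'c) position \<Rightarrow> bool" where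
  "all_colored G h \<longleftrightarrow> edges G \<subseteq> colored_edges h"

(* The legal moves do not depend on which player is to move. *)

definition breaker_has_won :: "'v graph \<Rightarrow> 'c set \<Rightarrow> ('v, 'c) position \<Rightarrow> bool" where
  "breaker_has_won G X h \<longleftrightarrow> \<not> all_colored G h \<and> \<not> (\<exists>mv. legal_move G X h mv)"

type_synonym ('v, 'c) strategy = "('v, 'c) position \<Rightarrow> ('v, 'c) move"

(* Positions reachable when Maker follows the strategy s and Breaker plays any legal moves. *)

inductive follows ::
  "'v graph \<Rightarrow> 'c set \<Rightarrow> nat \<Rightarrow> ('v, 'c) strategy \<Rightarrow> ('v, 'c) position \<Rightarrow> bool"
  for G :: "'v graph" and X :: "'c set" and m :: nat and s :: "('v, 'c) strategy"
where
  start: "follows G X m s []"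
| maker: "follows G X m s h \<Longrightarrow> maker_to_move m h \<Longrightarrow> legal_move G X h (s h) \<Longrightarrow>
            follows G X m s (h @ [s h])"
| breaker: "follows G X m s h \<Longrightarrow> \<not> maker_to_move m h \<Longrightarrow> legal_move G X h mv \<Longrightarrow>
            follows G X m s (h @ [mv])"

(* Every move colors a new edge, so on a finite graph every play ends, and it ends either with
   all edges colored or with a win for Breaker.  Hence Maker wins with s if s always supplies a
   legal move when Maker needs one and no win for Breaker is reachable. *)

definition winning_strategy ::
  "'v graph \<Rightarrow> 'c set \<Rightarrow> nat \<Rightarrow> ('v, 'c) strategy \<Rightarrow> bool" where
  "winning_strategy G X m s \<longleftrightarrow>
     (\<forall>h. follows G X m s h \<longrightarrow>
        \<not> breaker_has_won G X h \<and>
        (maker_to_move m h \<and> \<not> all_colored G h \<longrightarrow> legal_move G X h (s h)))"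

definition maker_wins :: "'v graph \<Rightarrow> 'c set \<Rightarrow> nat \<Rightarrow> bool" where
  "maker_wins G X m \<longleftrightarrow> (\<exists>s. winning_strategy G X m s)"

(* The (m,1)-game chromatic index.  Only the number of colors matters, so the k colors are
   taken to be the numbers below k.  On a finite graph some k always qualifies (the number of
   edges, for instance). *)

definition game_chromatic_index :: "'v graph \<Rightarrow> nat \<Rightarrow> nat" where
  "game_chromatic_index G m = (LEAST k. maker_wins G {..<k} m)"

end

(* Maker's strategy in W_3, and in W_4 with four colors when m is not 3, is to complete a seed: a
   partial coloring R such that every uncolored edge already sees, in R, all colors but one.
   Then all later moves are forced and lead to one complete coloring.  The three
   spokes of W_3, or four suitable edges of W_4, form a seed.  When m = 2, Maker opens with two
   disjoint edges of one color in W_3, or with two opposite spokes in W_4, and every reply of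
   Breaker is compatible with a seed that needs at most two further moves.  With five colors and m = 3, Maker colors
   the spokes of W_4; a rim edge has only four neighbors and can always be colored.

   For m = 3 and four colors Breaker uses that the relation "spoke not adjacent to rim edge" is an
   8-cycle on the edges of W_4, and that the color classes of a complete coloring form one of the
   two perfect matchings of this cycle.  After three moves there is an uncolored edge e that, in
   each matching still possible, is matched with a colored edge: if two consecutive
   edges of the 8-cycle are colored, then only one matching is possible, and a colored edge has an
   uncolored partner; otherwise two colored edges are at distance two, and e lies between them.
   Breaker gives e an unused color. *)

theory Submission
  imports Defs
begin

subsection \<open>Winning positions and partial colorings\<close>

text \<open>Backward analysis of the game tree: the least set of positions from which Maker can
  force a complete coloring. Breaker's rule demands a legal move because a stuck position is a win
  for Breaker.\<close>

inductive wins :: "'v graph \<Rightarrow> 'c set \<Rightarrow> nat \<Rightarrow> ('v, 'c) position \<Rightarrow> bool"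
  for G X m where
  wins_done: "all_colored G h \<Longrightarrow> wins G X m h"
| wins_maker: "maker_to_move m h \<Longrightarrow> legal_move G X h mv \<Longrightarrow> wins G X m (h @ [mv]) \<Longrightarrow> wins G X m h"
| wins_breaker: "\<not> maker_to_move m h \<Longrightarrow> \<exists>mv. legal_move G X h mv \<Longrightarrow>
    (\<And>mv. legal_move G X h mv \<Longrightarrow> wins G X m (h @ [mv])) \<Longrightarrow> wins G X m h"

lemma not_all_colored_if_legal: "legal_move G X h mv \<Longrightarrow> \<not> all_colored G h"
  by (auto simp: legal_move_def all_colored_def)

text \<open>Maker always chooses some move that stays in \<open>wins\<close>. Breaker cannot leave
  \<open>wins\<close>, and no position in it is stuck.\<close>

lemma maker_wins_if_wins:
  assumes "wins G X m []"
  shows "maker_wins G X m"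
proof -
  define s where "s = (\<lambda>h. SOME mv. legal_move G X h mv \<and> wins G X m (h @ [mv]))"
  have s: "legal_move G X h (s h) \<and> wins G X m (h @ [s h])"
    if "wins G X m h" "maker_to_move m h" "\<not> all_colored G h" for h
    unfolding s_def by (rule someI_ex) (use that in \<open>blast elim: wins.cases\<close>)
  have reach: "wins G X m h" if "follows G X m s h" for h
    using that
  proof induction
    case start
    show ?case by (fact assms)
  next
    case (maker h)
    then show ?case using s not_all_colored_if_legal by blast
  next
    case (breaker h mv)
    from breaker.IH show ?case
      by cases (use breaker.hyps not_all_colored_if_legal in blast)+
  qed
  have "\<not> breaker_has_won G X h" if "wins G X m h" for h
    using that by cases (auto simp: breaker_has_won_def)
  then have "winning_strategy G X m s"
    unfolding winning_strategy_def using reach s by blast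
  then show ?thesis
    unfolding maker_wins_def by blast
qed

lemma card_uncolored_less:
  assumes "finite (edges G)" "legal_move G X h mv"
  shows "card (edges G - colored_edges (h @ [mv])) < card (edges G - colored_edges h)"
  by (rule psubset_card_mono) (use assms in \<open>auto simp: legal_move_def colored_edges_def\<close>)

text \<open>Nobody has to choose well here: both players preserve \<open>P\<close>, \<open>P\<close>
  prevents getting stuck, and each move lowers the number of uncolored edges.\<close>

lemma wins_if_invariant:
  assumes fin: "finite (edges G)" and "P h"
    and step: "\<And>h mv. P h \<Longrightarrow> legal_move G X h mv \<Longrightarrow> P (h @ [mv])"
    and ex: "\<And>h. P h \<Longrightarrow> \<not> all_colored G h \<Longrightarrow> \<exists>mv. legal_move G X h mv"
  shows "wins G X m h"
  using \<open>P h\<close>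
proof (induction "card (edges G - colored_edges h)" arbitrary: h rule: less_induct)
  case less
  have IH: "wins G X m (h @ [mv])" if "legal_move G X h mv" for mv
    using less that step card_uncolored_less[OF fin] by blast
  show ?case
  proof (cases "all_colored G h")
    case False
    then obtain mv where "legal_move G X h mv"
      using ex[OF less.prems] by blast
    then show ?thesis
      using IH wins_maker[of m h G X mv] wins_breaker[of m h G X] by blast
  qed (rule wins_done)
qed

text \<open>The equivalence covers two conditions: read from left to right, a nonempty edge has only
  one color; read from right to left, the coloring is proper.\<close>

definition partial_coloring :: "'v graph \<Rightarrow> 'c set \<Rightarrow> ('v, 'c) move set \<Rightarrow> bool" where
  "partial_coloring G X P \<longleftrightarrow>
     (\<forall>(e, c)\<in>P. e \<in> edges G \<and> c \<in> X \<and>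
        (\<forall>(f, d)\<in>P. e \<inter> f \<noteq> {} \<longrightarrow> (e = f \<longleftrightarrow> c = d)))"

definition edge_coloring :: "'v graph \<Rightarrow> 'c set \<Rightarrow> ('v, 'c) move set \<Rightarrow> bool" where
  "edge_coloring G X T \<longleftrightarrow> partial_coloring G X T \<and> fst ` T = edges G"

lemma partial_coloring_unique:
  assumes "partial_coloring G X T" "(e, c) \<in> T" "(f, d) \<in> T" "e \<inter> f \<noteq> {}"
  shows "e = f \<longleftrightarrow> c = d"
  using assms unfolding partial_coloring_def by blast

lemma edge_coloring_unique:
  assumes "edge_coloring G X T" "(e, c) \<in> T" "(f, d) \<in> T" "e \<inter> f \<noteq> {}"
  shows "e = f \<longleftrightarrow> c = d"
  using partial_coloring_unique[of G X, OF _ assms(2-4)] assms(1) by (simp add: edge_coloring_def)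

lemma partial_coloring_append:
  assumes P: "partial_coloring G X (set h)" and legal: "legal_move G X h mv"
  shows "partial_coloring G X (set (h @ [mv]))"
proof -
  obtain e c where mv: "mv = (e, c)" by fastforce
  have new: "e \<noteq> f \<and> c \<noteq> d" if "(f, d) \<in> set h" "e \<inter> f \<noteq> {}" for f d
    using legal that unfolding legal_move_def colored_edges_def mv by force
  have "f = g \<longleftrightarrow> x = y"
    if "(f, x) \<in> set (h @ [mv])" "(g, y) \<in> set (h @ [mv])" "f \<inter> g \<noteq> {}" for f x g y
    using that new[of f x] new[of g y] partial_coloring_unique[OF P, of f x g y]
    by (auto simp: mv Int_commute)
  moreover have "f \<in> edges G \<and> x \<in> X" if "(f, x) \<in> set (h @ [mv])" for f x
    using that P legal by (auto simp: partial_coloring_def legal_move_def mv)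
  ultimately show ?thesis
    unfolding partial_coloring_def by blast
qed

text \<open>This makes \<open>R\<close> a seed of \<open>T\<close>: a move outside \<open>T\<close>
  is impossible once \<open>R\<close> has been played. All quantifiers are bounded, so concrete
  instances can be evaluated.\<close>

definition determines :: "'v graph \<Rightarrow> 'c set \<Rightarrow> ('v, 'c) move set \<Rightarrow> ('v, 'c) move set \<Rightarrow> bool" where
  "determines G X R T \<longleftrightarrow> R \<subseteq> T \<and>
     (\<forall>e\<in>edges G. \<forall>c\<in>X. (e, c) \<in> T \<or> e \<in> fst ` R \<or> (\<exists>(f, d)\<in>R. d = c \<and> e \<inter> f \<noteq> {}))"

lemma legal_if_in_coloring:
  assumes "edge_coloring G X T" "set h \<subseteq> T" "(e, c) \<in> T" "e \<notin> colored_edges h"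
  shows "legal_move G X h (e, c)"
proof -
  have "c \<noteq> d" if "(f, d) \<in> set h" "e \<inter> f \<noteq> {}" for f d
  proof -
    have "e \<noteq> f"
      using that assms(4) by (force simp: colored_edges_def)
    then show ?thesis
      using edge_coloring_unique[OF assms(1,3)] that assms(2) by blast
  qed
  moreover have "e \<in> edges G" "c \<in> X"
    using assms(1,3) by (auto simp: edge_coloring_def partial_coloring_def)
  ultimately show ?thesis
    using assms(4) by (auto simp: legal_move_def)
qed

lemma wins_if_determined:
  assumes "finite (edges G)" and T: "edge_coloring G X T" and R: "determines G X R T"
    and "set h \<subseteq> T" "R \<subseteq> set h"
  shows "wins G X m h"
proof (rule wins_if_invariant[where P = "\<lambda>h. set h \<subseteq> T \<and> R \<subseteq> set h"])
  show "set (h @ [mv]) \<subseteq> T \<and> R \<subseteq> set (h @ [mv])"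
    if "set h \<subseteq> T \<and> R \<subseteq> set h" "legal_move G X h mv" for h mv
  proof -
    obtain e c where "mv = (e, c)" by fastforce
    with that(2) have legal: "e \<in> edges G" "c \<in> X" "e \<notin> fst ` set h"
      "\<forall>(f, d)\<in>set h. e \<inter> f \<noteq> {} \<longrightarrow> c \<noteq> d"
      by (simp_all add: legal_move_def colored_edges_def)
    have "e \<notin> fst ` R" "\<not> (\<exists>(f, d)\<in>R. d = c \<and> e \<inter> f \<noteq> {})"
      using that(1) legal(3,4) by fast+
    moreover have "(e, c) \<in> T \<or> e \<in> fst ` R \<or> (\<exists>(f, d)\<in>R. d = c \<and> e \<inter> f \<noteq> {})"
      using R legal(1,2) by (simp add: determines_def)
    ultimately have "(e, c) \<in> T" by satx
    with \<open>mv = (e, c)\<close> that show ?thesis by auto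
  qed
next
  show "\<exists>mv. legal_move G X h mv" if h: "set h \<subseteq> T \<and> R \<subseteq> set h" "\<not> all_colored G h" for h
  proof -
    obtain e where "e \<in> edges G" "e \<notin> colored_edges h"
      using h unfolding all_colored_def by blast
    moreover from this obtain c where "(e, c) \<in> T"
      using T unfolding edge_coloring_def by force
    ultimately show ?thesis
      using legal_if_in_coloring[OF T] h by blast
  qed
qed (use assms in auto)

text \<open>The numerical hypothesis says that the moves left in Maker's current turn suffice for
  the missing part of the seed, so Breaker cannot interfere before it is complete.\<close>

lemma wins_by_seed:
  assumes fin: "finite (edges G)" and T: "edge_coloring G X T" "{} \<notin> edges G"
    and R: "determines G X R T" "finite R"
    and "set h \<subseteq> T" "length h mod (m + 1) + card (R - set h) \<le> m"
  shows "wins G X m h"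
  using assms(6,7)
proof (induction "card (R - set h)" arbitrary: h)
  case 0
  then have "R \<subseteq> set h" using R by simp
  then show ?case using wins_if_determined[OF fin T(1) R(1)] 0 by blast
next
  case (Suc n)
  from Suc.hyps(2) obtain mv where mv: "mv \<in> R" "mv \<notin> set h"
    by (metis Diff_iff all_not_in_conv card.empty nat.distinct(1))
  obtain e c where ec: "mv = (e, c)" by fastforce
  have inT: "(e, c) \<in> T" using mv ec R by (auto simp: determines_def)
  have "e \<notin> colored_edges h"
  proof
    assume "e \<in> colored_edges h"
    then obtain d where d: "(e, d) \<in> set h" by (auto simp: colored_edges_def)
    moreover have "e \<noteq> {}"
      using inT T by (force simp: edge_coloring_def)
    ultimately have "c = d"
      using edge_coloring_unique[OF T(1) inT, of e d] Suc.prems(1) by blast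
    with d mv ec show False by simp
  qed
  then have legal: "legal_move G X h mv"
    using legal_if_in_coloring[OF T(1)] Suc.prems(1) inT ec by simp
  have "R - set (h @ [mv]) = (R - set h) - {mv}" by auto
  then have card: "card (R - set (h @ [mv])) = n"
    using Suc.hyps(2) mv R(2) by simp
  \<comment> \<open>The position inside the round is below \<open>m\<close>: Maker is to move, and
    the next move does not wrap around to a new round.\<close>
  have len: "length h mod (m + 1) + Suc n \<le> m"
    using Suc by simp
  then have "length (h @ [mv]) mod (m + 1) = Suc (length h mod (m + 1))"
    by (simp add: mod_Suc)
  then have "wins G X m (h @ [mv])"
    using Suc.hyps(1)[of "h @ [mv]"] card len Suc.prems(1) inT ec by simp
  moreover have "maker_to_move m h"
    using len by (simp add: maker_to_move_def)
  ultimately show ?case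
    using wins_maker legal by blast
qed

text \<open>Only colors of colored neighbors are blocked, and each such neighbor blocks a single
  color.\<close>

lemma legal_color_exists:
  assumes "e \<in> edges G" "e \<notin> colored_edges h"
    and "partial_coloring G X (set h)" "{} \<notin> edges G"
    and few: "card {f \<in> colored_edges h. e \<inter> f \<noteq> {}} < card X"
  shows "\<exists>c. legal_move G X h (e, c)"
proof -
  let ?P = "{p \<in> set h. e \<inter> fst p \<noteq> {}}"
  \<comment> \<open>Since nonempty edges carry one color each, counting moves is the same as
    counting colored edges.\<close>
  have "inj_on fst ?P"
  proof (rule inj_onI)
    fix p q assume pq: "p \<in> ?P" "q \<in> ?P" "fst p = fst q"
    obtain f c d where "p = (f, c)" "q = (f, d)"
      using pq(3) by (cases p, cases q) simp
    moreover from this pq assms(3,4) have "f \<inter> f \<noteq> {}" by auto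
    ultimately show "p = q"
      using partial_coloring_unique[OF assms(3), of f c f d] pq(1,2) by simp
  qed
  moreover have "fst ` ?P = {f \<in> colored_edges h. e \<inter> f \<noteq> {}}"
    by (auto simp: colored_edges_def)
  moreover have fin: "finite ?P" by simp
  ultimately have "card (snd ` ?P) < card X"
    using few card_image[of fst ?P] card_image_le[OF fin, of snd] by simp
  then have "\<not> X \<subseteq> snd ` ?P"
    using card_mono[of "snd ` ?P" X] fin by (meson finite_imageI leD)
  then obtain c where "c \<in> X" "c \<notin> snd ` ?P" by blast
  moreover from this have "c \<noteq> d" if "(f, d) \<in> set h" "e \<inter> f \<noteq> {}" for f d
    using that by (force simp: image_iff)
  ultimately have "legal_move G X h (e, c)"
    using assms(1,2) unfolding legal_move_def fst_conv snd_conv by blast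
  then show ?thesis ..
qed

section \<open>Completions of a play, and the lower bound on the number of colors\<close>

lemma follows_partial_coloring: "follows G X m s h \<Longrightarrow> partial_coloring G X (set h)"
proof (induction rule: follows.induct)
  case start
  show ?case by (simp add: partial_coloring_def)
qed (blast intro: partial_coloring_append)+

text \<open>Playing on with \<open>s\<close> and arbitrary legal replies ends in a complete
  coloring. Breaker therefore refutes a strategy by reaching a position without such an
  extension.\<close>

lemma edge_coloring_extends_play:
  assumes "finite (edges G)" "winning_strategy G X m s" "follows G X m s h"
  shows "\<exists>T. edge_coloring G X T \<and> set h \<subseteq> T"
  using assms(3)
proof (induction "card (edges G - colored_edges h)" arbitrary: h rule: less_induct)
  case less
  show ?case
  proof (cases "all_colored G h")
    case True
    then have "edge_coloring G X (set h)"
      using follows_partial_coloring[OF less.prems]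
      by (auto simp: edge_coloring_def all_colored_def colored_edges_def partial_coloring_def)
    then show ?thesis by blast
  next
    case False
    then have "maker_to_move m h \<longrightarrow> legal_move G X h (s h)" "\<exists>mv. legal_move G X h mv"
      using assms(2) less.prems unfolding winning_strategy_def breaker_has_won_def by blast+
    then obtain mv where "legal_move G X h mv" "follows G X m s (h @ [mv])"
      using follows.maker[OF less.prems] follows.breaker[OF less.prems] by blast
    then show ?thesis
      using less.hyps[of "h @ [mv]"] card_uncolored_less[OF assms(1), of X h mv] by auto
  qed
qed

lemma finite_edges_wheel [simp]: "finite (edges (wheel n))"
  by (simp add: wheel_def cycle_graph_def)

lemma empty_notin_wheel [simp]: "{} \<notin> edges (wheel n)"
  by (auto simp: wheel_def cycle_graph_def)

text \<open>The \<open>n\<close> spokes meet in the hub, so a complete coloring gives them distinct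
  colors.\<close>

lemma maker_wins_wheel_ge:
  assumes "maker_wins (wheel n) {..<k} m"
  shows "n \<le> k"
proof -
  obtain T where T: "edge_coloring (wheel n) {..<k} T"
    using assms edge_coloring_extends_play[OF finite_edges_wheel _ follows.start]
    unfolding maker_wins_def by blast
  have "\<exists>c. ({n, i}, c) \<in> T" if "i < n" for i
  proof -
    have "{n, i} \<in> fst ` T"
      using T that by (auto simp: edge_coloring_def wheel_def cycle_graph_def)
    then show ?thesis by force
  qed
  then have "\<exists>col. \<forall>i<n. ({n, i}, col i) \<in> T"
    by (intro choice) blast
  then obtain col where col: "({n, i}, col i) \<in> T" if "i < n" for i by blast
  have "inj_on col {..<n}"
  proof (rule inj_onI)
    fix i j assume "i \<in> {..<n}" "j \<in> {..<n}" "col i = col j"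
    then have "{n, i} = {n, j}"
      using edge_coloring_unique[OF T col[of i] col[of j]] by simp
    then show "i = j" by (auto simp: doubleton_eq_iff)
  qed
  moreover have "col ` {..<n} \<subseteq> {..<k}"
    using col T unfolding edge_coloring_def partial_coloring_def by blast
  ultimately show ?thesis
    using card_inj_on_le[of col "{..<n}" "{..<k}"] by simp
qed

subsection \<open>Breaker wins on the wheel with four spokes, four colors and m = 3\<close>

text \<open>The color class of the edge number \<open>j\<close> of the 8-cycle in the perfect matching \<open>d\<close>.\<close>

definition color_class :: "bool \<Rightarrow> nat \<Rightarrow> nat" where
  "color_class d j = (if d then j else (j + 1) mod 8) div 2"

lemma all_less_8:
  "(\<forall>j<8. P j) \<longleftrightarrow> P 0 \<and> P 1 \<and> P 2 \<and> P 3 \<and> P 4 \<and> P 5 \<and> P 6 \<and> P (7::nat)"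
  by (simp add: numeral_eq_Suc All_less_Suc conj_ac)

text \<open>The edges of the 8-cycle alternate between the two matchings. Hence two consecutive
  colored elements reveal the matching.\<close>

lemma color_class_next:
  assumes "a < 8"
  shows "color_class d a = color_class d ((a + 1) mod 8) \<longleftrightarrow> (d \<longleftrightarrow> even a)"
proof -
  have "\<forall>a<8. color_class d a = color_class d ((a + 1) mod 8) \<longleftrightarrow> (d \<longleftrightarrow> even a)"
    unfolding all_less_8 by (simp add: color_class_def)
  with assms show ?thesis by blast
qed

text \<open>The partner of \<open>j\<close> in the matching \<open>d\<close>; adding 7 is stepping
  back by one modulo 8.\<close>

definition mate :: "bool \<Rightarrow> nat \<Rightarrow> nat" where
  "mate d j = (if d \<longleftrightarrow> even j then j + 1 else j + 7) mod 8"

lemma mate: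
  assumes "j < 8"
  shows "mate d j < 8" "mate d j \<noteq> j" "mate d (mate d j) = j"
    "color_class d (mate d j) = color_class d j"
proof -
  have "\<forall>j<8. mate d j < 8 \<and> mate d j \<noteq> j \<and> mate d (mate d j) = j \<and>
      color_class d (mate d j) = color_class d j"
    unfolding all_less_8 by (simp add: mate_def color_class_def)
  then show "mate d j < 8" "mate d j \<noteq> j" "mate d (mate d j) = j"
    "color_class d (mate d j) = color_class d j"
    using assms by auto
qed

text \<open>Three cyclic gaps of length at least 3 would need a cycle of length at least 9.\<close>

lemma three_in_8_cycle:
  assumes "card S = 3" "S \<subseteq> {..<8::nat}"
  shows "\<exists>a\<in>S. (a + 1) mod 8 \<in> S \<or> (a + 2) mod 8 \<in> S"
proof -
  obtain x y z where xyz: "S = {x, y, z}" "x \<noteq> y" "x \<noteq> z" "y \<noteq> z"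
    using assms(1) by (auto simp: card_3_iff)
  then consider "x < y" "y < z" | "x < z" "z < y" | "y < x" "x < z" | "y < z" "z < x"
    | "z < x" "x < y" | "z < y" "y < x" by linarith
  then obtain j k l where S: "S = {j, k, l}" "j < k" "k < l"
    using xyz(1) by cases (auto simp: insert_commute)
  then have "l < 8" using assms(2) by auto
  have "j + 1 = k \<or> j + 2 = k \<or> k + 1 = l \<or> k + 2 = l \<or> (l + 1) mod 8 = j \<or> (l + 2) mod 8 = j"
  proof (rule ccontr)
    assume *: "\<not> ?thesis"
    then have "j + 3 \<le> k" "k + 3 \<le> l"
      using S(2,3) by linarith+
    with \<open>l < 8\<close> have "l = 6 \<and> j = 0 \<or> l = 7 \<and> j = 0 \<or> l = 7 \<and> j = 1"
      by arith
    with * show False by auto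
  qed
  then show ?thesis
    using S \<open>l < 8\<close> by auto
qed

text \<open>A fixed-point-free involution cannot pair off a set of odd size.\<close>

lemma unpaired_in_3_set:
  assumes "card S = 3" "S \<subseteq> {..<8}"
  shows "\<exists>e\<in>S. mate d e \<notin> S"
proof -
  obtain j k l where S: "S = {j, k, l}" "j \<noteq> k" "j \<noteq> l" "k \<noteq> l"
    using assms(1) by (auto simp: card_3_iff)
  then have "j < 8" "k < 8" "l < 8" using assms(2) by auto
  then show ?thesis
    using mate(2,3)[of j d] mate(2,3)[of k d] mate(2,3)[of l d] S by auto
qed

text \<open>\<open>S\<close> will be the set of colored edges and \<open>d\<close> the matching of
  one completion. The matchings \<open>d'\<close> that agree with \<open>d\<close> on
  \<open>S\<close> are those still possible, and \<open>e\<close> is the edge for Breaker to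
  spoil.\<close>

lemma breaker_edge:
  assumes "card S = 3" "S \<subseteq> {..<8}"
  shows "\<exists>e<8. e \<notin> S \<and>
    (\<forall>d'. (\<forall>a\<in>S. \<forall>b\<in>S. color_class d' a = color_class d' b \<longleftrightarrow> color_class d a = color_class d b)
      \<longrightarrow> (\<exists>a\<in>S. color_class d' a = color_class d' e))"
proof (cases "\<exists>a\<in>S. (a + 1) mod 8 \<in> S")
  case True
  then obtain a where a: "a \<in> S" "(a + 1) mod 8 \<in> S" by blast
  obtain f where f: "f \<in> S" "mate d f \<notin> S"
    using unpaired_in_3_set[OF assms] by blast
  have "a < 8" "f < 8" using a f assms(2) by auto
  show ?thesis
  proof (intro exI[of _ "mate d f"] conjI allI impI)
    fix d'
    assume "\<forall>a\<in>S. \<forall>b\<in>S. color_class d' a = color_class d' b \<longleftrightarrow> color_class d a = color_class d b"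
    then have "d' = d"
      using a color_class_next[OF \<open>a < 8\<close>] by blast
    then show "\<exists>a\<in>S. color_class d' a = color_class d' (mate d f)"
      using f mate(4)[OF \<open>f < 8\<close>, of d] by force
  qed (use f mate(1)[OF \<open>f < 8\<close>] in auto)
next
  case False
  then obtain a where a: "a \<in> S" "(a + 2) mod 8 \<in> S"
    using three_in_8_cycle[OF assms] by blast
  define e where "e = (a + 1) mod 8"
  have "a < 8" "e < 8" using a assms(2) by (auto simp: e_def)
  have next_e: "(e + 1) mod 8 = (a + 2) mod 8"
    unfolding e_def by (simp add: mod_simps)
  \<comment> \<open>Reduction modulo 8 keeps parity. So one matching pairs \<open>e\<close> with
    \<open>a\<close> and the other pairs it with the successor of \<open>e\<close>, and both of
    these lie in \<open>S\<close>.\<close>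
  have "even e \<longleftrightarrow> odd a"
    using \<open>a < 8\<close> unfolding e_def by (cases "a = 7") auto
  then have "color_class d' a = color_class d' e \<or> color_class d' ((a + 2) mod 8) = color_class d' e" for d'
    using color_class_next[OF \<open>a < 8\<close>, of d'] color_class_next[OF \<open>e < 8\<close>, of d']
    unfolding next_e e_def[symmetric] by auto
  then have "\<exists>a\<in>S. color_class d' a = color_class d' e" for d'
    using a by blast
  moreover have "e \<notin> S"
    using False a(1) by (simp add: e_def)
  ultimately show ?thesis
    using \<open>e < 8\<close> by blast
qed

text \<open>Consecutive edges (also the last and the first) are a spoke and a rim edge that are not
  adjacent; the spokes have the even numbers.\<close>

definition wheel4_edge :: "nat \<Rightarrow> nat set" where
  "wheel4_edge j = [{4, 0}, {1, 2}, {4, 3}, {0, 1}, {4, 2}, {3, 0}, {4, 1}, {2, 3}] ! j"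

lemma edges_wheel_4: "edges (wheel 4) = wheel4_edge ` {..<8}"
  by code_simp

lemma inj_wheel4_edge: "inj_on wheel4_edge {..<8}"
  by code_simp

section \<open>Complete four-colorings of \<open>wheel 4\<close>\<close>

lemma color_function:
  assumes "edge_coloring (wheel 4) X T"
  shows "\<exists>\<phi>. \<forall>j<8. (wheel4_edge j, \<phi> j) \<in> T"
proof (intro choice allI)
  fix j
  have "wheel4_edge j \<in> fst ` T" if "j < 8"
    using assms that unfolding edge_coloring_def edges_wheel_4 by blast
  then show "\<exists>c. j < 8 \<longrightarrow> (wheel4_edge j, c) \<in> T" by force
qed

text \<open>The spokes use up all four colors, so each rim edge repeats the color of one of its two
  neighbors in the 8-cycle. Adjacent rim edges differ, so the choice made at one rim edge propagates
  around the rim.\<close>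

lemma coloring_classes:
  assumes T: "edge_coloring (wheel 4) {..<4::nat} T"
    and \<phi>: "\<forall>j<8. (wheel4_edge j, \<phi> j) \<in> T"
  shows "\<exists>d. \<forall>a<8. \<forall>b<8. \<phi> a = \<phi> b \<longleftrightarrow> color_class d a = color_class d b"
proof -
  have range: "\<phi> j < 4" if "j < 8" for j
  proof -
    have "(wheel4_edge j, \<phi> j) \<in> T" using \<phi> that by blast
    then show ?thesis
      using T unfolding edge_coloring_def partial_coloring_def by blast
  qed
  have neq: "\<phi> j \<noteq> \<phi> k"
    if "j < 8" "k < 8" "wheel4_edge j \<noteq> wheel4_edge k" "wheel4_edge j \<inter> wheel4_edge k \<noteq> {}" for j k
  proof -
    have "(wheel4_edge j, \<phi> j) \<in> T" "(wheel4_edge k, \<phi> k) \<in> T" using \<phi> that by blast+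
    then show ?thesis
      using edge_coloring_unique[OF T] that(3,4) by blast
  qed
  have spokes: "\<phi> 0 \<noteq> \<phi> 2" "\<phi> 0 \<noteq> \<phi> 4" "\<phi> 0 \<noteq> \<phi> 6" "\<phi> 2 \<noteq> \<phi> 4" "\<phi> 2 \<noteq> \<phi> 6" "\<phi> 4 \<noteq> \<phi> 6"
    by (rule neq; simp add: wheel4_edge_def doubleton_eq_iff)+
  have rim_spoke: "\<phi> 1 \<noteq> \<phi> 6" "\<phi> 1 \<noteq> \<phi> 4" "\<phi> 3 \<noteq> \<phi> 0" "\<phi> 3 \<noteq> \<phi> 6"
    "\<phi> 5 \<noteq> \<phi> 2" "\<phi> 5 \<noteq> \<phi> 0" "\<phi> 7 \<noteq> \<phi> 4" "\<phi> 7 \<noteq> \<phi> 2"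
    by (rule neq; simp add: wheel4_edge_def doubleton_eq_iff)+
  have rims: "\<phi> 1 \<noteq> \<phi> 3" "\<phi> 1 \<noteq> \<phi> 7" "\<phi> 7 \<noteq> \<phi> 5" "\<phi> 5 \<noteq> \<phi> 3"
    by (rule neq; simp add: wheel4_edge_def doubleton_eq_iff)+
  have "{\<phi> 0, \<phi> 2, \<phi> 4, \<phi> 6} = {..<4}"
    using range spokes by (intro card_subset_eq) auto
  then have spoke_color: "\<phi> j = \<phi> 0 \<or> \<phi> j = \<phi> 2 \<or> \<phi> j = \<phi> 4 \<or> \<phi> j = \<phi> 6" if "j < 8" for j
    using range[OF that] by blast
  have "\<phi> 1 = \<phi> 0 \<and> \<phi> 3 = \<phi> 2 \<and> \<phi> 5 = \<phi> 4 \<and> \<phi> 7 = \<phi> 6 \<or>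
        \<phi> 1 = \<phi> 2 \<and> \<phi> 3 = \<phi> 4 \<and> \<phi> 5 = \<phi> 6 \<and> \<phi> 7 = \<phi> 0"
    using spoke_color[of 1] spoke_color[of 3] spoke_color[of 5] spoke_color[of 7] rim_spoke rims
    by simp metis
  then show ?thesis
  proof
    assume "\<phi> 1 = \<phi> 0 \<and> \<phi> 3 = \<phi> 2 \<and> \<phi> 5 = \<phi> 4 \<and> \<phi> 7 = \<phi> 6"
    then show ?thesis
      unfolding all_less_8 using spokes
      by (intro exI[of _ True]) (simp add: color_class_def)
  next
    assume "\<phi> 1 = \<phi> 2 \<and> \<phi> 3 = \<phi> 4 \<and> \<phi> 5 = \<phi> 6 \<and> \<phi> 7 = \<phi> 0"
    then show ?thesis
      unfolding all_less_8 using spokes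
      by (intro exI[of _ False]) (simp add: color_class_def)
  qed
qed

section \<open>Breaker's reply to the first three moves\<close>

lemma follows_colored_edges:
  assumes "follows G X m s h"
  shows "colored_edges h \<subseteq> edges G \<and> card (colored_edges h) = length h"
  using assms by (induction rule: follows.induct) (auto simp: colored_edges_def legal_move_def)

lemma follows_opening:
  assumes s: "winning_strategy G X m s" and "n \<le> m" "n \<le> card (edges G)"
  shows "\<exists>h. follows G X m s h \<and> length h = n"
  using assms(2,3)
proof (induction n)
  case 0
  show ?case using follows.start by fastforce
next
  case (Suc n)
  then obtain h where h: "follows G X m s h" "length h = n" by auto
  have move: "maker_to_move m h"
    using h Suc.prems by (simp add: maker_to_move_def)
  have "colored_edges h \<noteq> edges G"
    using follows_colored_edges[OF h(1)] h(2) Suc.prems by auto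
  then have "\<not> all_colored G h"
    using follows_colored_edges[OF h(1)] by (auto simp: all_colored_def)
  then have "legal_move G X h (s h)"
    using s h move unfolding winning_strategy_def by blast
  then show ?case
    using follows.maker[OF h(1) move] h(2) by fastforce
qed

lemma breaker_wins_wheel_4: "\<not> maker_wins (wheel 4) {..<4::nat} 3"
proof
  assume "maker_wins (wheel 4) {..<4::nat} 3"
  then obtain s where s: "winning_strategy (wheel 4) {..<4::nat} 3 s"
    unfolding maker_wins_def by blast
  have "card (edges (wheel 4)) = 8"
    by (simp add: edges_wheel_4 card_image inj_wheel4_edge)
  then obtain h where h: "follows (wheel 4) {..<4} 3 s h" "length h = 3"
    using follows_opening[OF s, of 3] by auto
  \<comment> \<open>This completion serves as a reference: it supplies the colors on
    \<open>S\<close> and one possible matching \<open>d\<close>.\<close>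
  obtain T where T: "edge_coloring (wheel 4) {..<4} T" "set h \<subseteq> T"
    using edge_coloring_extends_play[OF finite_edges_wheel s h(1)] by blast
  obtain \<phi> where \<phi>: "\<forall>j<8. (wheel4_edge j, \<phi> j) \<in> T"
    using color_function[OF T(1)] by blast
  obtain d where d: "\<forall>a<8. \<forall>b<8. \<phi> a = \<phi> b \<longleftrightarrow> color_class d a = color_class d b"
    using coloring_classes[OF T(1) \<phi>] by blast
  define S where "S = {j. j < 8 \<and> wheel4_edge j \<in> colored_edges h}"
  have S8: "S \<subseteq> {..<8}" by (auto simp: S_def)
  have "wheel4_edge ` S = colored_edges h"
    using follows_colored_edges[OF h(1)] unfolding S_def edges_wheel_4 by auto
  then have cardS: "card S = 3"
    using follows_colored_edges[OF h(1)] h(2) card_image[OF inj_on_subset[OF inj_wheel4_edge S8]]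
    by simp
  have nonempty: "wheel4_edge j \<noteq> {}" if "j < 8" for j
    using that empty_notin_wheel[of 4] unfolding edges_wheel_4 by auto
  have color_h: "c = \<phi> j" if "j < 8" "(wheel4_edge j, c) \<in> set h" for j c
  proof -
    have "(wheel4_edge j, c) \<in> T" "(wheel4_edge j, \<phi> j) \<in> T"
      using that T(2) \<phi> by blast+
    then show ?thesis
      using edge_coloring_unique[OF T(1)] nonempty[OF that(1)] by blast
  qed
  have in_h: "(wheel4_edge j, \<phi> j) \<in> set h" if "j \<in> S" for j
  proof -
    have "j < 8" using that by (simp add: S_def)
    from that obtain c where "(wheel4_edge j, c) \<in> set h"
      by (auto simp: S_def colored_edges_def)
    with color_h[OF \<open>j < 8\<close> this] show ?thesis by simp
  qed
  obtain e where e: "e < 8" "e \<notin> S"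
    and e_class: "\<And>d'. \<forall>a\<in>S. \<forall>b\<in>S. color_class d' a = color_class d' b \<longleftrightarrow> color_class d a = color_class d b
      \<Longrightarrow> \<exists>a\<in>S. color_class d' a = color_class d' e"
    using breaker_edge[OF cardS S8, of d] by blast
  have "finite S" using S8 finite_subset by blast
  \<comment> \<open>Three edges use at most three colors. A color that occurs nowhere is legal on
    every uncolored edge.\<close>
  then have "\<not> {..<4} \<subseteq> \<phi> ` S"
    using card_mono[of "\<phi> ` S" "{..<4}"] card_image_le[of S \<phi>] cardS by fastforce
  then obtain c where c: "c < 4" "c \<notin> \<phi> ` S" by blast
  have unused: "c \<noteq> x" if "(f, x) \<in> set h" for f x
  proof -
    have "f \<in> colored_edges h" using that by (force simp: colored_edges_def)
    then obtain j where j: "j \<in> S" "f = wheel4_edge j"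
      using \<open>wheel4_edge ` S = colored_edges h\<close> by blast
    then have "x = \<phi> j"
      using color_h[of j x] that S8 by blast
    with j c show ?thesis by blast
  qed
  have "wheel4_edge e \<in> edges (wheel 4)" "wheel4_edge e \<notin> colored_edges h"
    using e by (auto simp: edges_wheel_4 S_def)
  then have "legal_move (wheel 4) {..<4} h (wheel4_edge e, c)"
    using c(1) unused unfolding legal_move_def by auto
  moreover have "\<not> maker_to_move 3 h"
    using h(2) by (simp add: maker_to_move_def)
  ultimately have follows: "follows (wheel 4) {..<4} 3 s (h @ [(wheel4_edge e, c)])"
    using follows.breaker[OF h(1)] by blast
  obtain T' where T': "edge_coloring (wheel 4) {..<4} T'" "set (h @ [(wheel4_edge e, c)]) \<subseteq> T'"
    using edge_coloring_extends_play[OF finite_edges_wheel s follows] by blast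
  obtain \<psi> where \<psi>: "\<forall>j<8. (wheel4_edge j, \<psi> j) \<in> T'"
    using color_function[OF T'(1)] by blast
  obtain d' where d': "\<forall>a<8. \<forall>b<8. \<psi> a = \<psi> b \<longleftrightarrow> color_class d' a = color_class d' b"
    using coloring_classes[OF T'(1) \<psi>] by blast
  have \<psi>_eq: "\<psi> j = x" if "j < 8" "(wheel4_edge j, x) \<in> T'" for j x
    using edge_coloring_unique[OF T'(1)] \<psi> that nonempty[OF that(1)] by blast
  have agree: "\<psi> a = \<phi> a" if "a \<in> S" for a
    using \<psi>_eq[of a "\<phi> a"] in_h[OF that] T'(2) that S8 by auto
  \<comment> \<open>The second completion has the old colors on \<open>S\<close>, so its matching is
    among those still possible. It must then repeat on \<open>S\<close> the color of
    \<open>e\<close>, although \<open>c\<close> does not occur there.\<close>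
  have "\<exists>a\<in>S. color_class d' a = color_class d' e"
  proof (rule e_class, intro ballI)
    fix a b assume ab: "a \<in> S" "b \<in> S"
    then have "a < 8" "b < 8" using S8 by auto
    then show "color_class d' a = color_class d' b \<longleftrightarrow> color_class d a = color_class d b"
      using d d' agree[OF ab(1)] agree[OF ab(2)] by metis
  qed
  then obtain a where a: "a \<in> S" "color_class d' a = color_class d' e" by blast
  then have "\<psi> a = \<psi> e"
    using d' e S8 by blast
  moreover have "\<psi> e = c"
    using \<psi>_eq[of e c] T'(2) e by simp
  ultimately show False
    using agree[OF a(1)] c(2) a(1) by auto
qed

subsection \<open>Strategies for Maker\<close>

text \<open>\<open>D\<close> is a table of completions, each with the moves that extend
  \<open>h\<close> to a seed of it. Every reply of Breaker lies in some completion of the table, and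
  Maker has a full turn to finish the corresponding seed.\<close>

lemma wins_by_seed_after_reply:
  assumes "finite (edges G)" "{} \<notin> edges G" "length h mod (m + 1) = m"
    and "legal_move G X h mv"
    and seeds: "\<forall>(T, R)\<in>D. edge_coloring G X T \<and> determines G X (set (h @ R)) T \<and> length R \<le> m"
    and cover: "\<forall>mv\<in>edges G \<times> X. legal_move G X h mv \<longrightarrow> mv \<in> \<Union> (fst ` D)"
  shows "wins G X m h"
proof (rule wins_breaker)
  show "\<not> maker_to_move m h"
    using assms(3) by (simp add: maker_to_move_def)
next
  fix mv assume legal: "legal_move G X h mv"
  then have "mv \<in> edges G \<times> X" by (cases mv) (auto simp: legal_move_def)
  with cover legal have "mv \<in> \<Union> (fst ` D)" by blast
  then obtain T R where TR: "(T, R) \<in> D" "mv \<in> T" by auto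
  have T: "edge_coloring G X T" "determines G X (set (h @ R)) T" "length R \<le> m"
    using bspec[OF seeds TR(1)] by simp_all
  have "card (set (h @ R) - set (h @ [mv])) \<le> card (set R)"
    by (rule card_mono) auto
  also have "\<dots> \<le> m"
    using card_length[of R] T(3) by simp
  finally have "card (set (h @ R) - set (h @ [mv])) \<le> m" .
  moreover have "length (h @ [mv]) mod (m + 1) = 0"
    using assms(3) by (simp add: mod_Suc)
  moreover have "set (h @ [mv]) \<subseteq> T"
    using T(2) TR(2) by (auto simp: determines_def)
  ultimately show "wins G X m (h @ [mv])"
    using wins_by_seed[OF assms(1) T(1) assms(2) T(2)] by simp
qed (use assms(4) in blast)

text \<open>The first \<open>m\<close> moves all belong to Maker, so a fixed legal opening may be
  prescribed.\<close>

lemma wins_opening: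
  assumes "wins G X m h" "\<forall>i\<in>{..<length h}. legal_move G X (take i h) (h ! i)" "length h \<le> m"
  shows "wins G X m []"
  using assms
proof (induction h rule: rev_induct)
  case (snoc mv h)
  have "legal_move G X h mv"
    using snoc.prems(2) by (force dest: bspec[of _ _ "length h"])
  moreover have "maker_to_move m h"
    using snoc.prems(3) by (simp add: maker_to_move_def)
  ultimately have "wins G X m h"
    using wins_maker snoc.prems(1) by blast
  moreover have "legal_move G X (take i h) (h ! i)" if "i < length h" for i
    using snoc.prems(2)[rule_format, of i] that by (simp add: nth_append)
  ultimately show ?case
    using snoc.IH snoc.prems(3) by simp
qed simp

text \<open>\<open>wheel 3\<close> is the complete graph on four vertices; the color classes are its
  three perfect matchings.\<close>

definition wheel3_coloring :: "nat \<Rightarrow> nat \<Rightarrow> (nat set \<times> nat) set" where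
  "wheel3_coloring p q =
     {({0, 1}, 0), ({3, 2}, 0), ({0, 2}, p), ({3, 1}, p), ({1, 2}, q), ({3, 0}, q)}"

lemma maker_wins_wheel_3:
  assumes "m \<ge> 2"
  shows "maker_wins (wheel 3) {..<3::nat} m"
proof (rule maker_wins_if_wins)
  show "wins (wheel 3) {..<3::nat} m []"
  proof (cases "m = 2")
    case False
    let ?R = "{({3, 0}, 2), ({3, 1}, 1), ({3, 2}, 0)} :: (nat set \<times> nat) set"
    have "edge_coloring (wheel 3) {..<3} (wheel3_coloring 1 2)"
      by code_simp
    moreover have "determines (wheel 3) {..<3} ?R (wheel3_coloring 1 2)"
      by code_simp
    moreover have "card ?R \<le> m"
      using assms False by (simp add: doubleton_eq_iff)
    ultimately show ?thesis
      by (intro wins_by_seed[of "wheel 3"]) auto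
  next
    case True
    \<comment> \<open>The opening fills one perfect matching. Any reply gives 1 or 2 to an edge of
      another one, which decides between the two completions.\<close>
    let ?h = "[({0, 1}, 0), ({3, 2}, 0)] :: (nat, nat) position"
    have "wins (wheel 3) {..<3::nat} 2 ?h"
    proof (rule wins_by_seed_after_reply)
      show "legal_move (wheel 3) {..<3} ?h ({0, 2}, 1)"
        by code_simp
      let ?D = "(\<lambda>(p, q). (wheel3_coloring p q, [({0, 2}, p), ({3, 1}, p)] :: (nat, nat) position)) `
        {(1, 2), (2, 1)}"
      show "\<forall>(T, R)\<in>?D. edge_coloring (wheel 3) {..<3} T \<and>
          determines (wheel 3) {..<3} (set (?h @ R)) T \<and> length R \<le> 2"
        by code_simp
      show "\<forall>mv\<in>edges (wheel 3) \<times> {..<3}. legal_move (wheel 3) {..<3} ?h mv \<longrightarrow>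
          mv \<in> \<Union> (fst ` ?D)"
        by code_simp
    qed simp_all
    moreover have "\<forall>i\<in>{..<length ?h}. legal_move (wheel 3) {..<3} (take i ?h) (?h ! i)"
      by code_simp
    ultimately have "wins (wheel 3) {..<3::nat} 2 []"
      using wins_opening[of "wheel 3" "{..<3}" 2 ?h] by simp
    with True show ?thesis by simp
  qed
qed

text \<open>Two opposite spokes are fixed, \<open>p\<close> and \<open>q\<close> color the other
  two, and \<open>d\<close> selects the matching of the 8-cycle. The value \<open>True\<close> here
  is the matching that \<open>color_class\<close> calls \<open>False\<close>.\<close>

definition wheel4_coloring :: "bool \<Rightarrow> nat \<Rightarrow> nat \<Rightarrow> (nat set \<times> nat) set" where
  "wheel4_coloring d p q =
     {({4, 0}, 0), ({4, 1}, p), ({4, 2}, 2), ({4, 3}, q)} \<union>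
     (if d then {({0, 1}, 2), ({1, 2}, q), ({2, 3}, 0), ({3, 0}, p)}
      else {({0, 1}, q), ({1, 2}, 0), ({2, 3}, p), ({3, 0}, 2)})"

definition wheel4_seed :: "bool \<Rightarrow> nat \<Rightarrow> nat \<Rightarrow> (nat set \<times> nat) list" where
  "wheel4_seed d p q =
     (if d then [({1, 2}, q), ({3, 0}, p)] else [({0, 1}, q), ({2, 3}, p)])"

lemma maker_wins_wheel_4:
  assumes "m \<ge> 2" "m \<noteq> 3"
  shows "maker_wins (wheel 4) {..<4::nat} m"
proof (rule maker_wins_if_wins)
  show "wins (wheel 4) {..<4::nat} m []"
  proof (cases "m = 2")
    case False
    \<comment> \<open>Here \<open>m\<close> is at least 4, so the whole seed fits into Maker's first
      turn.\<close>
    let ?R = "[({4, 0}, 0), ({4, 2}, 2)] @ wheel4_seed True 1 3"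
    have "edge_coloring (wheel 4) {..<4} (wheel4_coloring True 1 3)"
      by code_simp
    moreover have "determines (wheel 4) {..<4} (set ?R) (wheel4_coloring True 1 3)"
      by code_simp
    moreover have "card (set ?R) \<le> m"
      using assms False card_length[of ?R] by (simp add: wheel4_seed_def)
    ultimately show ?thesis
      by (intro wins_by_seed[of "wheel 4"]) auto
  next
    case True
    let ?h = "[({4, 0}, 0), ({4, 2}, 2)] :: (nat, nat) position"
    have "wins (wheel 4) {..<4::nat} 2 ?h"
    proof (rule wins_by_seed_after_reply)
      show "legal_move (wheel 4) {..<4} ?h ({4, 1}, 1)"
        by code_simp
      let ?D = "(\<lambda>(d, p, q). (wheel4_coloring d p q, wheel4_seed d p q)) `
        {(True, 1, 3), (True, 3, 1), (False, 1, 3), (False, 3, 1)}"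
      show "\<forall>(T, R)\<in>?D. edge_coloring (wheel 4) {..<4} T \<and>
          determines (wheel 4) {..<4} (set (?h @ R)) T \<and> length R \<le> 2"
        by code_simp
      show "\<forall>mv\<in>edges (wheel 4) \<times> {..<4}. legal_move (wheel 4) {..<4} ?h mv \<longrightarrow>
          mv \<in> \<Union> (fst ` ?D)"
        by code_simp
    qed simp_all
    moreover have "\<forall>i\<in>{..<length ?h}. legal_move (wheel 4) {..<4} (take i ?h) (?h ! i)"
      by code_simp
    ultimately have "wins (wheel 4) {..<4::nat} 2 []"
      using wins_opening[of "wheel 4" "{..<4}" 2 ?h] by simp
    with True show ?thesis by simp
  qed
qed

text \<open>Only rim edges remain, and each is adjacent to two spokes and two rim edges. Four
  neighbors cannot block five colors, whoever moves.\<close>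

lemma wins_if_spokes_colored:
  assumes "partial_coloring (wheel 4) {..<5::nat} (set h)"
    and "\<forall>i<4. {4, i} \<in> colored_edges h"
  shows "wins (wheel 4) {..<5::nat} m h"
proof (rule wins_if_invariant[where P = "\<lambda>h. partial_coloring (wheel 4) {..<5} (set h) \<and>
    (\<forall>i<4. {4, i} \<in> colored_edges h)"])
  show "partial_coloring (wheel 4) {..<5} (set (h @ [mv])) \<and> (\<forall>i<4. {4, i} \<in> colored_edges (h @ [mv]))"
    if "partial_coloring (wheel 4) {..<5} (set h) \<and> (\<forall>i<4. {4, i} \<in> colored_edges h)"
      "legal_move (wheel 4) {..<5} h mv" for h mv
    using that partial_coloring_append[of "wheel 4" "{..<5}" h mv] by (simp add: colored_edges_def)
next
  show "\<exists>mv. legal_move (wheel 4) {..<5::nat} h mv"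
    if h: "partial_coloring (wheel 4) {..<5} (set h) \<and> (\<forall>i<4. {4, i} \<in> colored_edges h)"
      "\<not> all_colored (wheel 4) h" for h
  proof -
    obtain e where e: "e \<in> edges (wheel 4)" "e \<notin> colored_edges h"
      using h(2) unfolding all_colored_def by blast
    have "e \<in> {{0, 1}, {1, 2}, {2, 3}, {3, 0}}"
    proof -
      have "edges (wheel 4) = {{0, 1}, {1, 2}, {2, 3}, {3, 0}} \<union> (\<lambda>i. {4, i}) ` {..<4}"
        by code_simp
      then show ?thesis using e h(1) by blast
    qed
    moreover have "\<forall>e\<in>{{0, 1}, {1, 2}, {2, 3}, {3, 0}}.
        card (Set.filter (\<lambda>f. f \<noteq> e \<and> e \<inter> f \<noteq> {}) (edges (wheel 4))) = 4"
      by code_simp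
    ultimately have "card (Set.filter (\<lambda>f. f \<noteq> e \<and> e \<inter> f \<noteq> {}) (edges (wheel 4))) = 4"
      by blast
    moreover have "colored_edges h \<subseteq> edges (wheel 4)"
      using h(1) by (auto simp: partial_coloring_def colored_edges_def)
    then have "{f \<in> colored_edges h. e \<inter> f \<noteq> {}} \<subseteq>
        Set.filter (\<lambda>f. f \<noteq> e \<and> e \<inter> f \<noteq> {}) (edges (wheel 4))"
      using e(2) by auto
    then have "card {f \<in> colored_edges h. e \<inter> f \<noteq> {}} \<le>
        card (Set.filter (\<lambda>f. f \<noteq> e \<and> e \<inter> f \<noteq> {}) (edges (wheel 4)))"
      by (rule card_mono[rotated]) simp
    ultimately have "card {f \<in> colored_edges h. e \<inter> f \<noteq> {}} < card {..<5::nat}"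
      by simp
    then show ?thesis
      using legal_color_exists[OF e] h(1) by fastforce
  qed
qed (use assms in auto)

lemma maker_wins_wheel_4_five_colors: "maker_wins (wheel 4) {..<5::nat} 3"
proof (rule maker_wins_if_wins)
  let ?h = "[({4, 0}, 0), ({4, 1}, 1), ({4, 2}, 2)] :: (nat, nat) position"
  have "partial_coloring (wheel 4) {..<5::nat} (set ?h)"
    by code_simp
  have "wins (wheel 4) {..<5::nat} 3 ?h"
  proof (rule wins_breaker)
    have "legal_move (wheel 4) {..<5::nat} ?h ({4, 3}, 3)"
      by code_simp
    then show "\<exists>mv. legal_move (wheel 4) {..<5::nat} ?h mv" by blast
  next
    fix mv assume mv: "legal_move (wheel 4) {..<5::nat} ?h mv"
    have part: "partial_coloring (wheel 4) {..<5::nat} (set (?h @ [mv]))"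
      by (rule partial_coloring_append) fact+
    have all_less_4: "(\<forall>i<4. P i) \<longleftrightarrow> P 0 \<and> P 1 \<and> P 2 \<and> P (3::nat)" for P
      by (simp add: numeral_eq_Suc All_less_Suc conj_ac)
    show "wins (wheel 4) {..<5::nat} 3 (?h @ [mv])"
    \<comment> \<open>Either Breaker has colored the last spoke, or Maker does so at once: only four
      edges are colored, so one of the five colors is free.\<close>
    proof (cases "{4, 3} \<in> colored_edges (?h @ [mv])")
      case True
      then show ?thesis
        by (intro wins_if_spokes_colored part) (simp add: all_less_4 colored_edges_def)
    next
      case False
      have "card {f \<in> colored_edges (?h @ [mv]). {4, 3} \<inter> f \<noteq> {}} \<le> card (colored_edges (?h @ [mv]))"
        by (rule card_mono) (auto simp: colored_edges_def)
      also have "\<dots> \<le> card (set (?h @ [mv]))"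
        unfolding colored_edges_def by (rule card_image_le) simp
      also have "\<dots> \<le> 4"
        using card_length[of "?h @ [mv]"] by simp
      finally have "card {f \<in> colored_edges (?h @ [mv]). {4, 3} \<inter> f \<noteq> {}} < card {..<5::nat}"
        by simp
      moreover have "{4, 3} \<in> edges (wheel 4)"
        by code_simp
      ultimately obtain c where c: "legal_move (wheel 4) {..<5} (?h @ [mv]) ({4, 3}, c)"
        using legal_color_exists[OF _ False part] by auto
      have "wins (wheel 4) {..<5} 3 ((?h @ [mv]) @ [({4, 3}, c)])"
        by (intro wins_if_spokes_colored partial_coloring_append part c)
          (simp add: all_less_4 colored_edges_def)
      then show ?thesis
        by (intro wins_maker[OF _ c]) (simp add: maker_to_move_def)
    qed
  qed (simp add: maker_to_move_def)
  moreover have "\<forall>i\<in>{..<length ?h}. legal_move (wheel 4) {..<5} (take i ?h) (?h ! i)"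
    by code_simp
  ultimately show "wins (wheel 4) {..<5::nat} 3 []"
    using wins_opening[of "wheel 4" "{..<5}" 3 ?h] by simp
qed

theorem theorem4p2:
  fixes m :: nat
  assumes "m \<ge> 2"
  shows "game_chromatic_index (wheel 3) m = 3 \<and>
         game_chromatic_index (wheel 4) m = (if m \<noteq> 3 then 4 else 5)"
proof
  show "game_chromatic_index (wheel 3) m = 3"
    unfolding game_chromatic_index_def
    using maker_wins_wheel_3[OF assms] maker_wins_wheel_ge by (rule Least_equality)
  have "game_chromatic_index (wheel 4) m = 4" if "m \<noteq> 3"
    unfolding game_chromatic_index_def
    using maker_wins_wheel_4[OF assms that] maker_wins_wheel_ge by (rule Least_equality)
  moreover have "game_chromatic_index (wheel 4) 3 = 5"
    unfolding game_chromatic_index_def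
  proof (rule Least_equality[where P = "\<lambda>k. maker_wins (wheel 4) {..<k} 3"])
    fix k :: nat assume k: "maker_wins (wheel 4) {..<k} 3"
    then have "k \<noteq> 4" using breaker_wins_wheel_4 by blast
    with maker_wins_wheel_ge[OF k] show "5 \<le> k" by simp
  qed (fact maker_wins_wheel_4_five_colors)
  ultimately show "game_chromatic_index (wheel 4) m = (if m \<noteq> 3 then 4 else 5)"
    by simp
qed

end
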